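(* Let $M$ be a compact $C^\infty$ Riemannian manifold and let $\alpha:\mathcal{H}\to \mathrm{Diff}^2(M)$ be an action of the discrete Heisenberg group $\mathcal{H}$; write $h=\alpha(\mathcal{C})$. Then all Lyapunov exponents of $h$ are zero with respect to any measure $\mu\in\mathcal{M}(M,\alpha)$ (that is, for every $\mu\in\mathcal{M}(M,\alpha)$, for $\mu$-a.e. $x$ and all $0\ne u\in T_xM$, $\lim_{n\to\infty}\frac1n\log\|Dh^n_xu\|=0$). In particular, for any integer $n>0$, if $h$ has only finitely many periodic points of period $n$, then for every periodic point $p$ of $h$ of period $n$ all eigenvalues of $Dh^n_p$ have modulus $1$.
   Context: The discrete Heisenberg group $\mathcal{H}$ is generated by $A,B,\mathcal{C}$ with relations $A\mathcal{C}=\mathcal{C}A$, $B\mathcal{C}=\mathcal{C}B$, $AB=BA\mathcal{C}$. An action is a group homomorphism $\alpha$ into a diffeomorphism group. $\mathcal{M}(M,\alpha)$ is the set of Borel probability measures $\mu$ on $M$ with $\alpha(k)_*\mu=\mu$ for all $k\in\mathcal{H}$. *)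

theory Defs
  imports "HOL-Probability.Probability" "HOL-Algebra.Group"
begin

section \<open>Groups given by generators and relations\<close>

text \<open>
  A word is a list of pairs \<open>(x, b)\<close>, standing for the generator \<open>x\<close> if \<open>b\<close> holds and for its
  formal inverse otherwise. A relation \<open>l = r\<close> is a pair of words \<open>(l, r)\<close>.
\<close>

type_synonym 'x gword = "('x \<times> bool) list"

inductive word_cong :: "('x gword \<times> 'x gword) set \<Rightarrow> 'x gword \<Rightarrow> 'x gword \<Rightarrow> bool"
  for R where
  refl: "word_cong R u u"
| sym: "word_cong R u v \<Longrightarrow> word_cong R v u"
| trans: "word_cong R u v \<Longrightarrow> word_cong R v w \<Longrightarrow> word_cong R u w"
| cancel: "word_cong R (u @ [(x, b), (x, \<not> b)] @ v) (u @ v)"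
| relation: "(l, r) \<in> R \<Longrightarrow> word_cong R (u @ l @ v) (u @ r @ v)"

definition word_class :: "('x gword \<times> 'x gword) set \<Rightarrow> 'x gword \<Rightarrow> 'x gword set" where
  "word_class R u = {v. word_cong R u v}"

definition presented_group :: "('x gword \<times> 'x gword) set \<Rightarrow> 'x gword set monoid" where
  "presented_group R =
     \<lparr>carrier = range (word_class R),
      mult = (\<lambda>X Y. {w. \<exists>u\<in>X. \<exists>v\<in>Y. word_cong R (u @ v) w}),
      one = word_class R []\<rparr>"

lemma word_cong_append_left: "word_cong R u v \<Longrightarrow> word_cong R (w @ u) (w @ v)"
proof (induction rule: word_cong.induct)
  case (cancel u x b v)
  then show ?case using word_cong.cancel[of R "w @ u" x b v] by simp
next
  case (relation l r u v)
  then show ?case using word_cong.relation[of l r R "w @ u" v] by simp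
qed (blast intro: word_cong.refl word_cong.sym word_cong.trans)+

lemma word_cong_append_right: "word_cong R u v \<Longrightarrow> word_cong R (u @ w) (v @ w)"
proof (induction rule: word_cong.induct)
  case (cancel u x b v)
  then show ?case using word_cong.cancel[of R u x b "v @ w"] by simp
next
  case (relation l r u v)
  then show ?case using word_cong.relation[of l r R u "v @ w"] by simp
qed (blast intro: word_cong.refl word_cong.sym word_cong.trans)+

lemma word_class_eq_iff: "word_class R u = word_class R v \<longleftrightarrow> word_cong R u v"
  unfolding word_class_def set_eq_iff mem_Collect_eq
  by (meson word_cong.refl word_cong.sym word_cong.trans)

lemma presented_group_mult:
  "word_class R u \<otimes>\<^bsub>presented_group R\<^esub> word_class R v = word_class R (u @ v)"
proof -
  have "word_cong R (u @ v) w"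
    if "word_cong R u u'" "word_cong R v v'" "word_cong R (u' @ v') w" for u' v' w
    using that by (meson word_cong.trans word_cong_append_left word_cong_append_right)
  then have "(\<exists>u'\<in>word_class R u. \<exists>v'\<in>word_class R v. word_cong R (u' @ v') w)
      \<longleftrightarrow> word_cong R (u @ v) w" for w
    unfolding word_class_def mem_Collect_eq Bex_def using word_cong.refl by blast
  then show ?thesis
    unfolding presented_group_def by (simp add: word_class_def)
qed

lemma word_cong_inverse:
  "word_cong R (map (\<lambda>(x, b). (x, \<not> b)) (rev u) @ u) []"
proof (induction u)
  case (Cons a u)
  obtain x b where a: "a = (x, b)" by (cases a)
  let ?i = "map (\<lambda>(x, b). (x, \<not> b)) (rev u)"
  have "word_cong R (?i @ [(x, \<not> b), (x, \<not> \<not> b)] @ u) (?i @ u)"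
    by (rule word_cong.cancel)
  then show ?case using word_cong.trans[OF _ Cons.IH] a by simp
qed (simp add: word_cong.refl)

lemma group_presented_group: "group (presented_group R)"
proof (rule groupI)
  fix X assume "X \<in> carrier (presented_group R)"
  then obtain u where X: "X = word_class R u" by (auto simp: presented_group_def)
  let ?i = "map (\<lambda>(x, b). (x, \<not> b)) (rev u)"
  show "\<exists>Y\<in>carrier (presented_group R). Y \<otimes>\<^bsub>presented_group R\<^esub> X = \<one>\<^bsub>presented_group R\<^esub>"
  proof
    show "word_class R ?i \<otimes>\<^bsub>presented_group R\<^esub> X = \<one>\<^bsub>presented_group R\<^esub>"
      unfolding X presented_group_mult
      by (simp add: presented_group_def word_class_eq_iff word_cong_inverse)
  qed (simp add: presented_group_def)
  show "\<one>\<^bsub>presented_group R\<^esub> \<otimes>\<^bsub>presented_group R\<^esub> X = X"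
    using presented_group_mult[of R "[]" u] X by (simp add: presented_group_def)
next
  fix X Y assume "X \<in> carrier (presented_group R)" "Y \<in> carrier (presented_group R)"
  then obtain u v where "X = word_class R u" "Y = word_class R v"
    by (auto simp: presented_group_def)
  then have "X \<otimes>\<^bsub>presented_group R\<^esub> Y = word_class R (u @ v)"
    by (simp add: presented_group_mult)
  then show "X \<otimes>\<^bsub>presented_group R\<^esub> Y \<in> carrier (presented_group R)"
    by (simp add: presented_group_def)
next
  fix X Y Z
  assume "X \<in> carrier (presented_group R)" "Y \<in> carrier (presented_group R)"
    "Z \<in> carrier (presented_group R)"
  then obtain u v w where "X = word_class R u" "Y = word_class R v" "Z = word_class R w"
    by (auto simp: presented_group_def)
  then show "X \<otimes>\<^bsub>presented_group R\<^esub> Y \<otimes>\<^bsub>presented_group R\<^esub> Z =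
      X \<otimes>\<^bsub>presented_group R\<^esub> (Y \<otimes>\<^bsub>presented_group R\<^esub> Z)"
    by (simp add: presented_group_mult)
qed (simp add: presented_group_def)

datatype heis_gen = Gen_A | Gen_B | Gen_C

definition heis_rels :: "(heis_gen gword \<times> heis_gen gword) set" where
  "heis_rels =
    (let a = (Gen_A, True); b = (Gen_B, True); c = (Gen_C, True)
     in {([a, c], [c, a]), ([b, c], [c, b]), ([a, b], [b, a, c])})"

definition heisenberg :: "heis_gen gword set monoid" where
  "heisenberg = presented_group heis_rels"

definition heis_C :: "heis_gen gword set" where
  "heis_C = word_class heis_rels [(Gen_C, True)]"

lemma group_heisenberg: "group heisenberg"
  unfolding heisenberg_def by (rule group_presented_group)


section \<open>Smooth manifolds\<close>

text \<open>
  \<open>Ck_on k f S\<close> is only meaningful for open \<open>S\<close>: \<open>f\<close> is differentiable at every point of \<open>S\<close> and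
  all its directional derivatives are of class \<open>k - 1\<close> (which in finite dimension is the usual
  notion of being \<open>k\<close> times continuously differentiable).
\<close>

primrec Ck_on ::
  "nat \<Rightarrow> ('a::euclidean_space \<Rightarrow> 'b::real_normed_vector) \<Rightarrow> 'a set \<Rightarrow> bool" where
  "Ck_on 0 f S \<longleftrightarrow> continuous_on S f"
| "Ck_on (Suc k) f S \<longleftrightarrow>
     (\<forall>x\<in>S. f differentiable (at x)) \<and> (\<forall>v. Ck_on k (\<lambda>x. frechet_derivative f (at x) v) S)"

definition smooth_on :: "('a::euclidean_space \<Rightarrow> 'b::real_normed_vector) \<Rightarrow> 'a set \<Rightarrow> bool" where
  "smooth_on f S \<longleftrightarrow> (\<forall>k. Ck_on k f S)"

text \<open>
  The manifold is a whole type \<open>'m\<close>. A chart is a pair of its domain and the coordinate map, whose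
  values outside the domain are irrelevant.
\<close>

type_synonym ('m, 'e) chart = "'m set \<times> ('m \<Rightarrow> 'e)"

definition chart_inv :: "('m, 'e) chart \<Rightarrow> 'e \<Rightarrow> 'm" where
  "chart_inv c = inv_into (fst c) (snd c)"

definition is_chart :: "('m::topological_space, 'e::euclidean_space) chart \<Rightarrow> bool" where
  "is_chart c \<longleftrightarrow> open (fst c) \<and> open (snd c ` fst c) \<and>
     homeomorphism (fst c) (snd c ` fst c) (snd c) (chart_inv c)"

definition local_rep :: "('m \<Rightarrow> 'm) \<Rightarrow> ('m, 'e) chart \<Rightarrow> ('m, 'e) chart \<Rightarrow> 'e \<Rightarrow> 'e" where
  "local_rep f c d = (\<lambda>y. snd d (f (chart_inv c y)))"

abbreviation transition :: "('m, 'e) chart \<Rightarrow> ('m, 'e) chart \<Rightarrow> 'e \<Rightarrow> 'e" where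
  "transition \<equiv> local_rep (\<lambda>x. x)"

text \<open>
  The atlas is not required to be maximal; the notions below do not change if it is enlarged
  to the maximal smooth atlas that contains it.
\<close>

definition smooth_atlas ::
  "('m::topological_space, 'e::euclidean_space) chart set \<Rightarrow> bool" where
  "smooth_atlas \<A> \<longleftrightarrow>
     (\<forall>c\<in>\<A>. is_chart c) \<and> (\<Union>c\<in>\<A>. fst c) = UNIV \<and>
     (\<forall>c\<in>\<A>. \<forall>d\<in>\<A>. smooth_on (transition c d) (snd c ` (fst c \<inter> fst d)))"

definition charts_at :: "('m, 'e) chart set \<Rightarrow> 'm \<Rightarrow> ('m, 'e) chart set" where
  "charts_at \<A> p = {c \<in> \<A>. p \<in> fst c}"

text \<open>
  A tangent vector at \<open>p\<close> is represented by the family of its coordinate vectors in all charts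
  around \<open>p\<close> (and \<open>0\<close> at the other indices), related by the derivatives of the chart transitions.
  The vector space operations are pointwise.
\<close>

type_synonym ('m, 'e) tangent = "('m, 'e) chart \<Rightarrow> 'e"

definition tangent_space ::
  "('m, 'e::euclidean_space) chart set \<Rightarrow> 'm \<Rightarrow> ('m, 'e) tangent set" where
  "tangent_space \<A> p =
     {v. (\<forall>c. c \<notin> charts_at \<A> p \<longrightarrow> v c = 0) \<and>
         (\<forall>c\<in>charts_at \<A> p. \<forall>d\<in>charts_at \<A> p.
            v d = frechet_derivative (transition c d) (at (snd c p)) (v c))}"

text \<open>The tangent vector at \<open>p\<close> with coordinate vector \<open>e\<close> in the chart \<open>c\<close>.\<close>

definition coord_vector ::
  "('m, 'e::euclidean_space) chart set \<Rightarrow> ('m, 'e) chart \<Rightarrow> 'm \<Rightarrow> 'e \<Rightarrow> ('m, 'e) tangent" where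
  "coord_vector \<A> c p e = (\<lambda>d. if d \<in> charts_at \<A> p
     then frechet_derivative (transition c d) (at (snd c p)) e else 0)"

definition riemannian_metric ::
  "('m::topological_space, 'e::euclidean_space) chart set \<Rightarrow>
   ('m \<Rightarrow> ('m, 'e) tangent \<Rightarrow> ('m, 'e) tangent \<Rightarrow> real) \<Rightarrow> bool" where
  "riemannian_metric \<A> g \<longleftrightarrow>
     (\<forall>p. \<forall>u\<in>tangent_space \<A> p. \<forall>v\<in>tangent_space \<A> p.
        g p u v = g p v u \<and>
        (\<forall>w\<in>tangent_space \<A> p. g p (\<lambda>c. u c + v c) w = g p u w + g p v w) \<and>
        (\<forall>a. g p (\<lambda>c. a *\<^sub>R u c) v = a * g p u v) \<and>
        (u \<noteq> (\<lambda>c. 0) \<longrightarrow> g p u u > 0)) \<and>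
     (\<forall>c\<in>\<A>. \<forall>e e'. smooth_on
        (\<lambda>y. let p = chart_inv c y in g p (coord_vector \<A> c p e) (coord_vector \<A> c p e'))
        (snd c ` fst c))"

definition tangent_norm ::
  "('m \<Rightarrow> ('m, 'e) tangent \<Rightarrow> ('m, 'e) tangent \<Rightarrow> real) \<Rightarrow> 'm \<Rightarrow> ('m, 'e) tangent \<Rightarrow> real" where
  "tangent_norm g p u = sqrt (g p u u)"


section \<open>Diffeomorphisms and their derivatives\<close>

definition Ck_map ::
  "nat \<Rightarrow> ('m::topological_space, 'e::euclidean_space) chart set \<Rightarrow> ('m \<Rightarrow> 'm) \<Rightarrow> bool" where
  "Ck_map k \<A> f \<longleftrightarrow> continuous_on UNIV f \<and>
     (\<forall>c\<in>\<A>. \<forall>d\<in>\<A>. Ck_on k (local_rep f c d) (snd c ` (fst c \<inter> f -` fst d)))"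

definition Diff ::
  "nat \<Rightarrow> ('m::topological_space, 'e::euclidean_space) chart set \<Rightarrow> ('m \<Rightarrow> 'm) monoid" where
  "Diff k \<A> =
     \<lparr>carrier = {f. bij f \<and> Ck_map k \<A> f \<and> Ck_map k \<A> (inv_into UNIV f)},
      mult = (\<circ>), one = id\<rparr>"

text \<open>
  The chart around \<open>p\<close> chosen here is immaterial for differentiable \<open>f\<close> and tangent vectors \<open>v\<close>,
  see \<open>differential_eq\<close> below.
\<close>

definition differential ::
  "('m, 'e::euclidean_space) chart set \<Rightarrow> ('m \<Rightarrow> 'm) \<Rightarrow> 'm \<Rightarrow> ('m, 'e) tangent \<Rightarrow> ('m, 'e) tangent"
  where
  "differential \<A> f p v = (\<lambda>d. if d \<in> charts_at \<A> (f p)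
     then (let c = (SOME c. c \<in> charts_at \<A> p)
           in frechet_derivative (local_rep f c d) (at (snd c p)) (v c))
     else 0)"

text \<open>
  \<open>z\<close> is an eigenvalue of (the complexification of) the real linear endomorphism \<open>L\<close> of \<open>V\<close>, with
  eigenvector \<open>u + \<i> w\<close>.
\<close>

definition complex_eigenvalue ::
  "('i \<Rightarrow> 'e::real_vector) set \<Rightarrow> (('i \<Rightarrow> 'e) \<Rightarrow> ('i \<Rightarrow> 'e)) \<Rightarrow> complex \<Rightarrow> bool" where
  "complex_eigenvalue V L z \<longleftrightarrow>
     (\<exists>u\<in>V. \<exists>w\<in>V. (u \<noteq> (\<lambda>i. 0) \<or> w \<noteq> (\<lambda>i. 0)) \<and>
        L u = (\<lambda>i. Re z *\<^sub>R u i - Im z *\<^sub>R w i) \<and>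
        L w = (\<lambda>i. Im z *\<^sub>R u i + Re z *\<^sub>R w i))"

lemma charts_at_nonempty: "smooth_atlas \<A> \<Longrightarrow> charts_at \<A> p \<noteq> {}"
  unfolding smooth_atlas_def charts_at_def by blast

lemma local_rep_differentiable:
  assumes A: "smooth_atlas \<A>" and f: "Ck_map (Suc k) \<A> f"
    and c: "c \<in> charts_at \<A> p" and d: "d \<in> charts_at \<A> (f p)"
  shows "local_rep f c d differentiable (at (snd c p))"
proof -
  have "Ck_on (Suc k) (local_rep f c d) (snd c ` (fst c \<inter> f -` fst d))"
    using f c d unfolding Ck_map_def charts_at_def by blast
  then show ?thesis using c d by (auto simp: charts_at_def)
qed

lemma Ck_map_id: "smooth_atlas \<A> \<Longrightarrow> Ck_map k \<A> (\<lambda>x. x)"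
  unfolding Ck_map_def smooth_atlas_def smooth_on_def by auto

lemma local_rep_compose:
  assumes A: "smooth_atlas \<A>" and f: "Ck_map (Suc k) \<A> f" and f': "Ck_map (Suc k) \<A> f'"
    and c: "c \<in> charts_at \<A> p" and d: "d \<in> charts_at \<A> (f p)" and e: "e \<in> charts_at \<A> (f' (f p))"
  shows "frechet_derivative (local_rep (f' \<circ> f) c e) (at (snd c p)) v =
    frechet_derivative (local_rep f' d e) (at (snd d (f p)))
      (frechet_derivative (local_rep f c d) (at (snd c p)) v)"
proof -
  have chc: "is_chart c" and chd: "is_chart d"
    using A c d by (auto simp: smooth_atlas_def charts_at_def)
  have invc: "chart_inv c (snd c x) = x" if "x \<in> fst c" for x
    using chc that by (auto simp: is_chart_def homeomorphism_def)
  have invd: "chart_inv d (snd d x) = x" if "x \<in> fst d" for x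
    using chd that by (auto simp: is_chart_def homeomorphism_def)
  have pc: "p \<in> fst c" and pd: "f p \<in> fst d" using c d by (auto simp: charts_at_def)
  let ?y = "snd c p" and ?F = "local_rep f c d" and ?G = "local_rep f' d e"
  let ?S = "snd c ` (fst c \<inter> f -` fst d)"
  have yF: "?F ?y = snd d (f p)" using invc pc by (simp add: local_rep_def)
  have "open (f -` fst d)"
    using f chd by (auto simp: Ck_map_def is_chart_def continuous_on_open_vimage)
  then have "openin (top_of_set (fst c)) (fst c \<inter> f -` fst d)" by auto
  then have "openin (top_of_set (snd c ` fst c)) ?S"
    using chc homeomorphism_imp_open_map unfolding is_chart_def by blast
  then have oS: "open ?S"
    using chc openin_open_trans by (auto simp: is_chart_def)
  have yS: "?y \<in> ?S" using pc pd by auto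
  have DF: "(?F has_derivative frechet_derivative ?F (at ?y)) (at ?y)"
    using local_rep_differentiable[OF A f c d] frechet_derivative_works by blast
  have DG: "(?G has_derivative frechet_derivative ?G (at (?F ?y))) (at (?F ?y))"
    using local_rep_differentiable[OF A f' d e] frechet_derivative_works yF by metis
  have "(?G \<circ> ?F has_derivative
      frechet_derivative ?G (at (?F ?y)) \<circ> frechet_derivative ?F (at ?y)) (at ?y)"
    by (rule diff_chain_at[OF DF DG])
  moreover have "(?G \<circ> ?F) z = local_rep (f' \<circ> f) c e z" if "z \<in> ?S" for z
    using that invc invd by (auto simp: local_rep_def)
  ultimately have "(local_rep (f' \<circ> f) c e has_derivative
      frechet_derivative ?G (at (?F ?y)) \<circ> frechet_derivative ?F (at ?y)) (at ?y)"
    using oS yS has_derivative_transform_within_open by blast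
  then show ?thesis
    using frechet_derivative_at yF by (metis comp_apply)
qed

lemma differential_eq:
  assumes A: "smooth_atlas \<A>" and f: "Ck_map (Suc k) \<A> f" and v: "v \<in> tangent_space \<A> p"
    and c: "c \<in> charts_at \<A> p" and d: "d \<in> charts_at \<A> (f p)"
  shows "differential \<A> f p v d = frechet_derivative (local_rep f c d) (at (snd c p)) (v c)"
proof -
  define c' where "c' = (SOME c. c \<in> charts_at \<A> p)"
  have c': "c' \<in> charts_at \<A> p" unfolding c'_def using c by (rule someI)
  have "v c = frechet_derivative (transition c' c) (at (snd c' p)) (v c')"
    using v c c' unfolding tangent_space_def by blast
  then show ?thesis
    using local_rep_compose[OF A Ck_map_id[OF A] f c' c d, of "v c'"] d
    by (simp add: differential_def c'_def[symmetric] o_def)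
qed

lemma differential_in_tangent_space:
  assumes A: "smooth_atlas \<A>" and f: "Ck_map (Suc k) \<A> f" and v: "v \<in> tangent_space \<A> p"
  shows "differential \<A> f p v \<in> tangent_space \<A> (f p)"
proof -
  obtain c where c: "c \<in> charts_at \<A> p" using charts_at_nonempty[OF A, of p] by blast
  have "differential \<A> f p v e =
      frechet_derivative (transition d e) (at (snd d (f p))) (differential \<A> f p v d)"
    if d: "d \<in> charts_at \<A> (f p)" and e: "e \<in> charts_at \<A> (f p)" for d e
    using local_rep_compose[OF A f Ck_map_id[OF A] c d e, of "v c"]
    unfolding o_def differential_eq[OF A f v c d] differential_eq[OF A f v c e] .
  moreover have "differential \<A> f p v d = 0" if "d \<notin> charts_at \<A> (f p)" for d
    using that by (simp add: differential_def)
  ultimately show ?thesis unfolding tangent_space_def by blast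
qed

lemma transition_refl:
  assumes A: "smooth_atlas \<A>" and c: "c \<in> charts_at \<A> p"
  shows "frechet_derivative (transition c c) (at (snd c p)) e = e"
proof -
  have ch: "is_chart c" "p \<in> fst c" using A c by (auto simp: smooth_atlas_def charts_at_def)
  have "((\<lambda>x. x) has_derivative (\<lambda>x. x)) (at (snd c p))" by (rule has_derivative_ident)
  moreover have "z = transition c c z" if "z \<in> snd c ` fst c" for z
    using that ch by (auto simp: local_rep_def is_chart_def homeomorphism_def)
  ultimately have "(transition c c has_derivative (\<lambda>x. x)) (at (snd c p))"
    using has_derivative_transform_within_open ch unfolding is_chart_def
    by (metis (no_types, lifting) imageI)
  then show ?thesis using frechet_derivative_at by metis
qed

lemma coord_vector_in_tangent_space:
  assumes A: "smooth_atlas \<A>" and c: "c \<in> charts_at \<A> p"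
  shows "coord_vector \<A> c p e \<in> tangent_space \<A> p" "coord_vector \<A> c p e c = e"
proof -
  have *: "frechet_derivative (transition c d') (at (snd c p)) e =
      frechet_derivative (transition d d') (at (snd d p))
        (frechet_derivative (transition c d) (at (snd c p)) e)"
    if d: "d \<in> charts_at \<A> p" and d': "d' \<in> charts_at \<A> p" for d d'
    using local_rep_compose[OF A Ck_map_id[OF A] Ck_map_id[OF A] c d d', of e]
    unfolding o_def .
  show "coord_vector \<A> c p e \<in> tangent_space \<A> p"
    unfolding tangent_space_def coord_vector_def mem_Collect_eq
  proof (intro conjI allI impI ballI)
    fix d d' assume d: "d \<in> charts_at \<A> p" and d': "d' \<in> charts_at \<A> p"
    show "(if d' \<in> charts_at \<A> p then frechet_derivative (transition c d') (at (snd c p)) e else 0) =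
      frechet_derivative (transition d d') (at (snd d p))
        (if d \<in> charts_at \<A> p then frechet_derivative (transition c d) (at (snd c p)) e else 0)"
      unfolding if_P[OF d] if_P[OF d'] by (rule *[OF d d'])
  qed (rule if_not_P)
  show "coord_vector \<A> c p e c = e"
    using transition_refl[OF A c] c by (simp add: coord_vector_def)
qed


section \<open>Invariant measures and Lyapunov exponents\<close>

definition invariant_measures ::
  "(heis_gen gword set \<Rightarrow> 'm \<Rightarrow> 'm::topological_space) \<Rightarrow> 'm measure set" where
  "invariant_measures \<alpha> = {\<mu>. prob_space \<mu> \<and> sets \<mu> = sets borel \<and>
     (\<forall>k\<in>carrier heisenberg. distr \<mu> borel (\<alpha> k) = \<mu>)}"

definition has_lyapunov_exponent ::
  "('m, 'e::euclidean_space) chart set \<Rightarrow> ('m \<Rightarrow> ('m, 'e) tangent \<Rightarrow> ('m, 'e) tangent \<Rightarrow> real) \<Rightarrow>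
   ('m \<Rightarrow> 'm) \<Rightarrow> 'm \<Rightarrow> ('m, 'e) tangent \<Rightarrow> real \<Rightarrow> bool" where
  "has_lyapunov_exponent \<A> g f x u l \<longleftrightarrow>
     (\<lambda>n. 1 / real n * ln (tangent_norm g ((f ^^ n) x) (differential \<A> (f ^^ n) x u)))
       \<longlonglongrightarrow> l"

end

theory Submission
  imports Defs "HOL-Library.Discrete_Functions" "HOL-Real_Asymp.Real_Asymp"
begin

text \<open>
  The central generator is distorted: since \<open>A\<^sup>n B\<^sup>n = B\<^sup>n A\<^sup>n C\<^bsup>n\<^sup>2\<^esup>\<close>, the element \<open>C\<^bsup>n\<^sup>2\<^esup>\<close> is a word
  of length \<open>4n\<close> in \<open>A\<close>, \<open>B\<close> and their inverses (\<open>heisenberg_central_square\<close>). On a compact manifold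
  the differential of a \<open>C\<^sup>1\<close> map stretches tangent vectors by a bounded factor
  (\<open>dilation_bounded\<close>), so if \<open>K\<close> bounds the factors of the generators, the chain rule bounds that
  of \<open>h\<^bsup>n\<^sup>2\<^esup>\<close> by \<open>K\<^bsup>4n\<^esup>\<close>. Filling in the exponents between consecutive squares, \<open>D h\<^sup>N\<close> stretches by at
  most \<open>exp (\<kappa> \<surd>N)\<close> at every point (\<open>dilation_central_subexponential\<close>). Exchanging \<open>A\<close> and \<open>B\<close>
  replaces \<open>C\<close> by its inverse, so the same holds for \<open>D h\<^bsup>-N\<^esup>\<close>, which bounds \<open>D h\<^sup>N\<close> from below
  (\<open>central_differential_bounds\<close>).

  Dividing the logarithm of these bounds by \<open>N\<close> shows that every exponent is zero, at every point
  and hence almost everywhere. If \<open>h\<^sup>n p = p\<close> and \<open>z\<close> is an eigenvalue of \<open>D h\<^sup>n\<close> at \<open>p\<close> with eigenvector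
  \<open>u + \<i> w\<close>, then \<open>\<bar>u\<bar>\<^sup>2 + \<bar>w\<bar>\<^sup>2\<close> is multiplied by \<open>\<bar>z\<bar>\<^sup>2\<close> at each step
  (\<open>eigenvector_norm_funpow\<close>), and a growth rate of at most \<open>exp (\<kappa> \<surd>(n m))\<close> in both directions
  forces \<open>\<bar>z\<bar> = 1\<close>.
\<close>

section \<open>Coordinates on tangent spaces\<close>

lemma linear_transition_derivative:
  assumes "smooth_atlas \<A>" "c \<in> charts_at \<A> p" "d \<in> charts_at \<A> p"
  shows "linear (frechet_derivative (transition c d) (at (snd c p)))"
  using local_rep_differentiable[OF assms(1) Ck_map_id[OF assms(1)] assms(2,3)]
  by (rule linear_frechet_derivative)

lemma tangent_space_lincomb:
  assumes A: "smooth_atlas \<A>" and u: "u \<in> tangent_space \<A> p" and w: "w \<in> tangent_space \<A> p"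
  shows "(\<lambda>i. a *\<^sub>R u i + b *\<^sub>R w i) \<in> tangent_space \<A> p"
  unfolding tangent_space_def mem_Collect_eq
proof (intro conjI allI impI ballI)
  fix c assume "c \<notin> charts_at \<A> p"
  then have "u c = 0" "w c = 0" using u w unfolding tangent_space_def by blast+
  then show "a *\<^sub>R u c + b *\<^sub>R w c = 0" by simp
next
  fix c d assume c: "c \<in> charts_at \<A> p" and d: "d \<in> charts_at \<A> p"
  note lin = linear_transition_derivative[OF A c d]
  have "u d = frechet_derivative (transition c d) (at (snd c p)) (u c)"
    "w d = frechet_derivative (transition c d) (at (snd c p)) (w c)"
    using u w c d unfolding tangent_space_def by blast+
  then show "a *\<^sub>R u d + b *\<^sub>R w d =
      frechet_derivative (transition c d) (at (snd c p)) (a *\<^sub>R u c + b *\<^sub>R w c)"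
    by (simp add: linear_add[OF lin] linear_scale[OF lin])
qed

lemma tangent_eq_coord_vector:
  assumes "u \<in> tangent_space \<A> p" "c \<in> charts_at \<A> p"
  shows "u = coord_vector \<A> c p (u c)"
proof
  fix d
  show "u d = coord_vector \<A> c p (u c) d"
  proof (cases "d \<in> charts_at \<A> p")
    case True
    have "u d = frechet_derivative (transition c d) (at (snd c p)) (u c)"
      using assms True unfolding tangent_space_def by blast
    then show ?thesis unfolding coord_vector_def if_P[OF True] .
  next
    case False
    have "u d = 0" using assms(1) False unfolding tangent_space_def by blast
    then show ?thesis unfolding coord_vector_def if_not_P[OF False] .
  qed
qed

lemma coord_vector_lincomb:
  assumes "smooth_atlas \<A>" "c \<in> charts_at \<A> p"
  shows "coord_vector \<A> c p (a *\<^sub>R e + b *\<^sub>R e') =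
    (\<lambda>i. a *\<^sub>R coord_vector \<A> c p e i + b *\<^sub>R coord_vector \<A> c p e' i)"
proof
  fix d
  show "coord_vector \<A> c p (a *\<^sub>R e + b *\<^sub>R e') d =
      a *\<^sub>R coord_vector \<A> c p e d + b *\<^sub>R coord_vector \<A> c p e' d"
  proof (cases "d \<in> charts_at \<A> p")
    case True
    note lin = linear_transition_derivative[OF assms True]
    show ?thesis using True
      by (simp add: coord_vector_def linear_add[OF lin] linear_scale[OF lin])
  qed (simp add: coord_vector_def)
qed

lemma metric_sym:
  assumes "riemannian_metric \<A> g" "u \<in> tangent_space \<A> p" "v \<in> tangent_space \<A> p"
  shows "g p u v = g p v u"
  using assms unfolding riemannian_metric_def by blast

lemma metric_pos:
  assumes "riemannian_metric \<A> g" "u \<in> tangent_space \<A> p" "u \<noteq> (\<lambda>c. 0)"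
  shows "g p u u > 0"
  using assms unfolding riemannian_metric_def by blast

lemma metric_lincomb_left:
  assumes A: "smooth_atlas \<A>" and g: "riemannian_metric \<A> g"
    and u: "u \<in> tangent_space \<A> p" and w: "w \<in> tangent_space \<A> p"
    and v: "v \<in> tangent_space \<A> p"
  shows "g p (\<lambda>i. a *\<^sub>R u i + b *\<^sub>R w i) v = a * g p u v + b * g p w v"
proof -
  have "(\<lambda>i. a *\<^sub>R u i) \<in> tangent_space \<A> p" "(\<lambda>i. b *\<^sub>R w i) \<in> tangent_space \<A> p"
    using tangent_space_lincomb[OF A u u, of a 0] tangent_space_lincomb[OF A w w, of b 0] by simp_all
  moreover have "g p (\<lambda>i. a *\<^sub>R u i) v = a * g p u v" "g p (\<lambda>i. b *\<^sub>R w i) v = b * g p w v"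
    using g u w v unfolding riemannian_metric_def by blast+
  moreover have add: "g p (\<lambda>c. u c + v c) w = g p u w + g p v w"
    if "u \<in> tangent_space \<A> p" "v \<in> tangent_space \<A> p" "w \<in> tangent_space \<A> p" for u v w
    using g that unfolding riemannian_metric_def by blast
  ultimately show ?thesis using v by (simp only: add)
qed

lemma metric_lincomb_right:
  assumes A: "smooth_atlas \<A>" and g: "riemannian_metric \<A> g"
    and u: "u \<in> tangent_space \<A> p" and w: "w \<in> tangent_space \<A> p"
    and v: "v \<in> tangent_space \<A> p"
  shows "g p v (\<lambda>i. a *\<^sub>R u i + b *\<^sub>R w i) = a * g p v u + b * g p v w"
  unfolding metric_sym[OF g v tangent_space_lincomb[OF A u w]] metric_lincomb_left[OF assms]
    metric_sym[OF g u v] metric_sym[OF g w v] ..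

lemma metric_zero:
  assumes "smooth_atlas \<A>" "riemannian_metric \<A> g" "u \<in> tangent_space \<A> p"
  shows "g p (\<lambda>c. 0) u = 0"
  using metric_lincomb_left[OF assms(1,2,3,3,3), of 0 0] by simp

lemma metric_nonneg:
  assumes "smooth_atlas \<A>" "riemannian_metric \<A> g" "u \<in> tangent_space \<A> p"
  shows "g p u u \<ge> 0"
  using metric_zero[OF assms] metric_pos[OF assms(2,3)] by fastforce

lemma tangent_norm_pos:
  assumes "riemannian_metric \<A> g" "u \<in> tangent_space \<A> p" "u \<noteq> (\<lambda>c. 0)"
  shows "tangent_norm g p u > 0"
  using metric_pos[OF assms] by (simp add: tangent_norm_def)

text \<open>
  For fixed \<open>y\<close> a bilinear form on the model space of the chart. Only in this form does it make
  sense to vary the point and the tangent vector together over a compact set.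
\<close>

definition coord_metric ::
  "('m, 'e::euclidean_space) chart set \<Rightarrow> ('m \<Rightarrow> ('m, 'e) tangent \<Rightarrow> ('m, 'e) tangent \<Rightarrow> real) \<Rightarrow>
   ('m, 'e) chart \<Rightarrow> 'e \<Rightarrow> 'e \<Rightarrow> 'e \<Rightarrow> real" where
  "coord_metric \<A> g c y e e' =
     g (chart_inv c y) (coord_vector \<A> c (chart_inv c y) e) (coord_vector \<A> c (chart_inv c y) e')"

lemma chart_inv_chart:
  assumes "smooth_atlas \<A>" "c \<in> charts_at \<A> p"
  shows "chart_inv c (snd c p) = p"
  using assms by (auto simp: smooth_atlas_def charts_at_def is_chart_def homeomorphism_def)

lemma chart_inv_in_charts_at:
  assumes "smooth_atlas \<A>" "c \<in> \<A>" "y \<in> snd c ` fst c"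
  shows "c \<in> charts_at \<A> (chart_inv c y)"
proof -
  obtain x where x: "x \<in> fst c" "y = snd c x" using assms(3) by blast
  then have "c \<in> charts_at \<A> x" using assms(2) by (simp add: charts_at_def)
  then show ?thesis using chart_inv_chart[OF assms(1)] x(2) by simp
qed

lemma metric_eq_coord_metric:
  assumes "smooth_atlas \<A>" "c \<in> charts_at \<A> p"
    and "u \<in> tangent_space \<A> p" "v \<in> tangent_space \<A> p"
  shows "g p u v = coord_metric \<A> g c (snd c p) (u c) (v c)"
  unfolding coord_metric_def chart_inv_chart[OF assms(1,2)]
  using tangent_eq_coord_vector[OF assms(3,2)] tangent_eq_coord_vector[OF assms(4,2)] by simp

lemma coord_metric_linear:
  assumes A: "smooth_atlas \<A>" and g: "riemannian_metric \<A> g"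
    and c: "c \<in> \<A>" and y: "y \<in> snd c ` fst c"
  shows "linear (\<lambda>e. coord_metric \<A> g c y e e')" "linear (coord_metric \<A> g c y e)"
proof -
  note ch = chart_inv_in_charts_at[OF A c y]
  note T = coord_vector_in_tangent_space(1)[OF A ch]
  have l: "linear f" if "\<And>a b e1 e2. f (a *\<^sub>R e1 + b *\<^sub>R e2) = a * f e1 + b * f e2"
    for f :: "'b \<Rightarrow> real"
    using that[of 1 _ 1] that[of _ _ 0] by (intro linearI) auto
  show "linear (\<lambda>e. coord_metric \<A> g c y e e')"
    by (rule l) (simp only: coord_metric_def coord_vector_lincomb[OF A ch]
        metric_lincomb_left[OF A g T T T])
  show "linear (coord_metric \<A> g c y e)"
    by (rule l) (simp only: coord_metric_def coord_vector_lincomb[OF A ch]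
        metric_lincomb_right[OF A g T T T])
qed

lemma linear_expand_basis:
  fixes f :: "'e::euclidean_space \<Rightarrow> 'b::real_vector"
  assumes "linear f"
  shows "f e = (\<Sum>i\<in>Basis. (e \<bullet> i) *\<^sub>R f i)"
proof -
  have "f e = f (\<Sum>i\<in>Basis. (e \<bullet> i) *\<^sub>R i)" by (simp only: euclidean_representation)
  also have "\<dots> = (\<Sum>i\<in>Basis. f ((e \<bullet> i) *\<^sub>R i))" by (rule linear_sum[OF assms])
  finally show ?thesis by (simp only: linear_scale[OF assms])
qed

lemma coord_metric_expand:
  assumes "smooth_atlas \<A>" "riemannian_metric \<A> g" "c \<in> \<A>" "y \<in> snd c ` fst c"
  shows "coord_metric \<A> g c y e e' =
    (\<Sum>i\<in>Basis. \<Sum>j\<in>Basis. (e \<bullet> i) * (e' \<bullet> j) * coord_metric \<A> g c y i j)"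
proof -
  have "coord_metric \<A> g c y e e' = (\<Sum>i\<in>Basis. (e \<bullet> i) * coord_metric \<A> g c y i e')"
    by (rule linear_expand_basis[OF coord_metric_linear(1)[OF assms], unfolded real_scaleR_def])
  also have "\<dots> = (\<Sum>i\<in>Basis. (e \<bullet> i) * (\<Sum>j\<in>Basis. (e' \<bullet> j) * coord_metric \<A> g c y i j))"
    by (intro sum.cong[OF HOL.refl] arg_cong[where f = "\<lambda>x. _ * x"]
        linear_expand_basis[OF coord_metric_linear(2)[OF assms], unfolded real_scaleR_def])
  finally show ?thesis by (simp add: sum_distrib_left mult.assoc)
qed

lemma coord_metric_scale:
  assumes "smooth_atlas \<A>" "riemannian_metric \<A> g" "c \<in> \<A>" "y \<in> snd c ` fst c"
  shows "coord_metric \<A> g c y (a *\<^sub>R e) (a *\<^sub>R e) = a\<^sup>2 * coord_metric \<A> g c y e e"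
  using linear_scale[OF coord_metric_linear(1)[OF assms]]
    linear_scale[OF coord_metric_linear(2)[OF assms]]
  by (simp add: power2_eq_square)

lemma coord_metric_pos:
  assumes A: "smooth_atlas \<A>" and g: "riemannian_metric \<A> g" and c: "c \<in> \<A>"
    and y: "y \<in> snd c ` fst c" and e: "e \<noteq> 0"
  shows "coord_metric \<A> g c y e e > 0"
proof -
  note ch = chart_inv_in_charts_at[OF A c y]
  have "coord_vector \<A> c (chart_inv c y) e \<noteq> (\<lambda>d. 0)"
    using coord_vector_in_tangent_space(2)[OF A ch, of e] e by metis
  then show ?thesis
    unfolding coord_metric_def
    by (rule metric_pos[OF g coord_vector_in_tangent_space(1)[OF A ch]])
qed

text \<open>
  The regularity of a Riemannian metric is a condition for each fixed pair of coordinate vectors.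
  Joint continuity follows since, by bilinearity, the value is a finite combination of
  the Gram coefficients at the basis vectors.
\<close>

lemma continuous_on_coord_metric:
  fixes \<A> :: "('m::topological_space, 'e::euclidean_space) chart set"
    and y e e' :: "'t::topological_space \<Rightarrow> 'e"
  assumes A: "smooth_atlas \<A>" and g: "riemannian_metric \<A> g" and c: "c \<in> \<A>"
    and y: "continuous_on T y" "y ` T \<subseteq> snd c ` fst c"
    and e: "continuous_on T e" "continuous_on T e'"
  shows "continuous_on T (\<lambda>t. coord_metric \<A> g c (y t) (e t) (e' t))"
proof -
  have "continuous_on (snd c ` fst c) (\<lambda>z. coord_metric \<A> g c z i j)" for i j
  proof -
    have "smooth_on (\<lambda>z. coord_metric \<A> g c z i j) (snd c ` fst c)"
      using g c unfolding riemannian_metric_def coord_metric_def Let_def by blast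
    then have "Ck_on 0 (\<lambda>z. coord_metric \<A> g c z i j) (snd c ` fst c)"
      unfolding smooth_on_def by blast
    then show ?thesis by simp
  qed
  then have "continuous_on T (\<lambda>t. coord_metric \<A> g c (y t) i j)" for i j
    using continuous_on_compose2[OF _ y] by blast
  then have "continuous_on T (\<lambda>t. \<Sum>i\<in>Basis. \<Sum>j\<in>Basis.
      (e t \<bullet> i) * (e' t \<bullet> j) * coord_metric \<A> g c (y t) i j)"
    by (intro continuous_intros e)
  moreover have "coord_metric \<A> g c (y t) (e t) (e' t) = (\<Sum>i\<in>Basis. \<Sum>j\<in>Basis.
      (e t \<bullet> i) * (e' t \<bullet> j) * coord_metric \<A> g c (y t) i j)" if "t \<in> T" for t
    using coord_metric_expand[OF A g c] y(2) that by blast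
  ultimately show ?thesis by (simp cong: continuous_on_cong)
qed

section \<open>Differentials\<close>

lemma differential_comp:
  assumes A: "smooth_atlas \<A>" and f: "Ck_map (Suc k) \<A> f" and f': "Ck_map (Suc k) \<A> f'"
    and ff': "Ck_map (Suc k) \<A> (f' \<circ> f)" and u: "u \<in> tangent_space \<A> p"
  shows "differential \<A> (f' \<circ> f) p u = differential \<A> f' (f p) (differential \<A> f p u)"
proof
  fix e
  obtain c d where c: "c \<in> charts_at \<A> p" and d: "d \<in> charts_at \<A> (f p)"
    using charts_at_nonempty[OF A] by blast
  show "differential \<A> (f' \<circ> f) p u e = differential \<A> f' (f p) (differential \<A> f p u) e"
  proof (cases "e \<in> charts_at \<A> (f' (f p))")
    case e: True
    then have e': "e \<in> charts_at \<A> ((f' \<circ> f) p)" by simp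
    show ?thesis
      unfolding differential_eq[OF A ff' u c e'] differential_eq[OF A f u c d]
        differential_eq[OF A f' differential_in_tangent_space[OF A f u] d e]
      by (rule local_rep_compose[OF A f f' c d e])
  qed (simp add: differential_def)
qed

lemma differential_ident:
  assumes A: "smooth_atlas \<A>" and u: "u \<in> tangent_space \<A> p"
  shows "differential \<A> (\<lambda>x. x) p u = u"
proof
  fix d
  show "differential \<A> (\<lambda>x. x) p u d = u d"
  proof (cases "d \<in> charts_at \<A> p")
    case True
    then show ?thesis
      using differential_eq[OF A Ck_map_id[OF A] u True, of d] transition_refl[OF A True] by simp
  next
    case False
    then have "u d = 0" using u unfolding tangent_space_def by blast
    then show ?thesis using False by (simp add: differential_def)
  qed
qed

lemma differential_lincomb:
  assumes A: "smooth_atlas \<A>" and f: "Ck_map (Suc k) \<A> f"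
    and u: "u \<in> tangent_space \<A> p" and w: "w \<in> tangent_space \<A> p"
  shows "differential \<A> f p (\<lambda>i. a *\<^sub>R u i + b *\<^sub>R w i) =
    (\<lambda>i. a *\<^sub>R differential \<A> f p u i + b *\<^sub>R differential \<A> f p w i)"
proof
  fix d
  obtain c where c: "c \<in> charts_at \<A> p" using charts_at_nonempty[OF A] by blast
  show "differential \<A> f p (\<lambda>i. a *\<^sub>R u i + b *\<^sub>R w i) d =
      a *\<^sub>R differential \<A> f p u d + b *\<^sub>R differential \<A> f p w d"
  proof (cases "d \<in> charts_at \<A> (f p)")
    case d: True
    note lin = linear_frechet_derivative[OF local_rep_differentiable[OF A f c d]]
    show ?thesis
      unfolding differential_eq[OF A f u c d] differential_eq[OF A f w c d]
        differential_eq[OF A f tangent_space_lincomb[OF A u w] c d]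
      by (simp add: linear_add[OF lin] linear_scale[OF lin])
  qed (simp add: differential_def)
qed

section \<open>Dilation\<close>

text \<open>
  Bounds on arbitrary subsets are needed for the passage from local to global by compactness.
\<close>

definition dilation_le_on ::
  "'m set \<Rightarrow> ('m, 'e::euclidean_space) chart set \<Rightarrow>
   ('m \<Rightarrow> ('m, 'e) tangent \<Rightarrow> ('m, 'e) tangent \<Rightarrow> real) \<Rightarrow> ('m \<Rightarrow> 'm) \<Rightarrow> real \<Rightarrow> bool" where
  "dilation_le_on S \<A> g f K \<longleftrightarrow> (\<forall>p\<in>S. \<forall>u\<in>tangent_space \<A> p.
     tangent_norm g (f p) (differential \<A> f p u) \<le> K * tangent_norm g p u)"

abbreviation "dilation_le \<equiv> dilation_le_on UNIV"

lemma dilation_le_on_mono: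
  assumes "smooth_atlas \<A>" "riemannian_metric \<A> g" "dilation_le_on S \<A> g f K" "K \<le> K'"
  shows "dilation_le_on S \<A> g f K'"
  unfolding dilation_le_on_def
proof (intro ballI)
  fix p u assume p: "p \<in> S" and u: "u \<in> tangent_space \<A> p"
  have "tangent_norm g (f p) (differential \<A> f p u) \<le> K * tangent_norm g p u"
    using assms(3) p u unfolding dilation_le_on_def by blast
  also have "\<dots> \<le> K' * tangent_norm g p u"
    using metric_nonneg[OF assms(1,2) u] assms(4) by (intro mult_right_mono) (simp_all add: tangent_norm_def)
  finally show "tangent_norm g (f p) (differential \<A> f p u) \<le> K' * tangent_norm g p u" .
qed

lemma dilation_le_comp:
  assumes A: "smooth_atlas \<A>" and f: "Ck_map (Suc k) \<A> f" and f': "Ck_map (Suc k) \<A> f'"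
    and ff': "Ck_map (Suc k) \<A> (f' \<circ> f)"
    and K: "dilation_le \<A> g f K" and K': "dilation_le \<A> g f' K'" "0 \<le> K'"
  shows "dilation_le \<A> g (f' \<circ> f) (K' * K)"
  unfolding dilation_le_on_def
proof (intro ballI)
  fix p u assume u: "u \<in> tangent_space \<A> p"
  have "tangent_norm g (f' (f p)) (differential \<A> f' (f p) (differential \<A> f p u))
      \<le> K' * tangent_norm g (f p) (differential \<A> f p u)"
    using K'(1) differential_in_tangent_space[OF A f u] unfolding dilation_le_on_def by blast
  also have "\<dots> \<le> K' * (K * tangent_norm g p u)"
    using K u K'(2) unfolding dilation_le_on_def by (intro mult_left_mono) auto
  finally show "tangent_norm g ((f' \<circ> f) p) (differential \<A> (f' \<circ> f) p u)
      \<le> K' * K * tangent_norm g p u"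
    unfolding differential_comp[OF A f f' ff' u] by (simp add: mult.assoc)
qed

lemma Ck_on_imp_continuous_on: "Ck_on k f S \<Longrightarrow> continuous_on S f"
  by (cases k) (auto intro: differentiable_imp_continuous_within continuous_at_imp_continuous_on)

text \<open>
  In charts, the squared ratio \<open>\<bar>Df e\<bar>\<^sup>2 / \<bar>e\<bar>\<^sup>2\<close> is a continuous function of the point \<open>y\<close> and of
  the coordinate vector \<open>e \<noteq> 0\<close>. It is bounded on the product of a closed ball of points and the
  unit sphere, which is compact, and it is unchanged when \<open>e\<close> is rescaled.
\<close>

lemma dilation_locally_bounded:
  fixes \<A> :: "('m::topological_space, 'e::euclidean_space) chart set"
  assumes A: "smooth_atlas \<A>" and g: "riemannian_metric \<A> g" and f: "Ck_map (Suc k) \<A> f"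
  shows "\<exists>U K. open U \<and> p \<in> U \<and> dilation_le_on U \<A> g f K"
proof -
  obtain c d where c: "c \<in> charts_at \<A> p" and d: "d \<in> charts_at \<A> (f p)"
    using charts_at_nonempty[OF A] by blast
  have cA: "c \<in> \<A>" "p \<in> fst c" and dA: "d \<in> \<A>" "f p \<in> fst d"
    using c d by (auto simp: charts_at_def)
  have chc: "is_chart c" and chd: "is_chart d"
    using A cA dA by (auto simp: smooth_atlas_def)
  define V where "V = fst c \<inter> f -` fst d"
  define S where "S = snd c ` V"
  define F where "F = local_rep f c d"
  define F' where "F' = (\<lambda>y e. frechet_derivative F (at y) e)"
  have "open (f -` fst d)"
    using f chd by (auto simp: Ck_map_def is_chart_def continuous_on_open_vimage)
  then have oV: "open V" using chc by (auto simp: V_def is_chart_def)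
  then have "openin (top_of_set (fst c)) V" by (auto simp: V_def openin_open)
  then have "openin (top_of_set (snd c ` fst c)) S"
    using chc homeomorphism_imp_open_map unfolding is_chart_def S_def by blast
  then have oS: "open S" using chc openin_open_trans by (auto simp: is_chart_def)
  have "snd c p \<in> S" using cA dA by (auto simp: S_def V_def)
  then obtain r where r: "r > 0" "cball (snd c p) r \<subseteq> S"
    using oS open_contains_cball by blast
  have S_sub: "S \<subseteq> snd c ` fst c" by (auto simp: S_def V_def)
  have F_S: "F y \<in> snd d ` fst d" if y: "y \<in> S" for y
  proof -
    obtain x where x: "x \<in> fst c" "f x \<in> fst d" "y = snd c x" using y by (auto simp: S_def V_def)
    have "c \<in> charts_at \<A> x" using cA(1) x(1) by (simp add: charts_at_def)
    then have "F y = snd d (f x)" by (simp add: F_def local_rep_def x(3) chart_inv_chart[OF A])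
    then show ?thesis using x(2) by simp
  qed
  have CF: "Ck_on (Suc k) F S"
    using f cA dA unfolding Ck_map_def F_def S_def V_def by blast
  then have contF: "continuous_on S F" by (rule Ck_on_imp_continuous_on)
  have contF': "continuous_on S (\<lambda>y. F' y v)" for v
    using CF unfolding F'_def by (auto intro: Ck_on_imp_continuous_on[of k])
  have linF': "linear (F' y)" if "y \<in> S" for y
    using CF that linear_frechet_derivative unfolding F'_def by auto

  define T where "T = cball (snd c p) r \<times> sphere (0::'e) 1"
  have T_S: "fst t \<in> S" if "t \<in> T" for t using that r(2) by (auto simp: T_def)
  \<comment> \<open>the squared norms of the image vector and of the vector itself, in coordinates\<close>
  define num where "num = (\<lambda>y e. coord_metric \<A> g d (F y) (F' y e) (F' y e))"
  define den where "den = (\<lambda>y e. coord_metric \<A> g c y e e)"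
  have cF: "continuous_on T (\<lambda>t. F (fst t))"
    using T_S by (intro continuous_on_compose2[OF contF] continuous_intros) auto
  have "continuous_on T (\<lambda>t. F' (fst t) v)" for v
    using T_S by (intro continuous_on_compose2[OF contF'] continuous_intros) auto
  then have "continuous_on T (\<lambda>t. \<Sum>i\<in>Basis. (snd t \<bullet> i) *\<^sub>R F' (fst t) i)"
    by (intro continuous_intros)
  moreover have "F' (fst t) (snd t) = (\<Sum>i\<in>Basis. (snd t \<bullet> i) *\<^sub>R F' (fst t) i)" if "t \<in> T" for t
    by (rule linear_expand_basis[OF linF'[OF T_S[OF that]]])
  ultimately have cF': "continuous_on T (\<lambda>t. F' (fst t) (snd t))"
    by (simp cong: continuous_on_cong)
  have cnum: "continuous_on T (\<lambda>t. num (fst t) (snd t))"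
    unfolding num_def using F_S T_S
    by (intro continuous_on_coord_metric[OF A g dA(1) cF _ cF' cF']) auto
  have cden: "continuous_on T (\<lambda>t. den (fst t) (snd t))"
    unfolding den_def using S_sub T_S
    by (intro continuous_on_coord_metric[OF A g cA(1)] continuous_intros) auto
  have den_pos: "den y e > 0" if "y \<in> S" "e \<noteq> 0" for y e
    unfolding den_def using coord_metric_pos[OF A g cA(1)] that S_sub by blast
  have den_T: "den (fst t) (snd t) \<noteq> 0" if t: "t \<in> T" for t
  proof -
    have "snd t \<noteq> 0" using t by (auto simp: T_def)
    then show ?thesis using den_pos[OF T_S[OF t]] by (metis less_irrefl)
  qed
  have "compact T" unfolding T_def by (intro compact_Times compact_cball compact_sphere)
  moreover have "continuous_on T (\<lambda>t. num (fst t) (snd t) / den (fst t) (snd t))"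
    using den_T by (intro continuous_on_divide cnum cden) blast
  ultimately have "bounded ((\<lambda>t. num (fst t) (snd t) / den (fst t) (snd t)) ` T)"
    by (intro compact_imp_bounded compact_continuous_image)
  then obtain B where B: "\<And>t. t \<in> T \<Longrightarrow> \<bar>num (fst t) (snd t) / den (fst t) (snd t)\<bar> \<le> B"
    unfolding bounded_iff by auto
  have bound: "num y e \<le> B * den y e" if y: "y \<in> cball (snd c p) r" for y and e :: 'e
  proof -
    have yS: "y \<in> S" using y r(2) by blast
    \<comment> \<open>a unit vector \<open>e1\<close> on the line of \<open>e\<close>; if \<open>e = 0\<close> any unit vector will do, with \<open>a = 0\<close>\<close>
    obtain a e1 where e1: "e = a *\<^sub>R e1" "norm e1 = 1"
    proof (cases "e = 0")
      case True
      then show ?thesis using that[of 0] vector_choose_size[of 1] by auto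
    next
      case False
      then show ?thesis using that[of "norm e" "e /\<^sub>R norm e"] by simp
    qed
    have "(y, e1) \<in> T" using y e1 by (simp add: T_def)
    then have "num y e1 / den y e1 \<le> B"
      using B[of "(y, e1)"] by (simp only: fst_conv snd_conv abs_le_iff)
    then have "num y e1 \<le> B * den y e1"
      using den_pos[OF yS, of e1] e1(2) by (simp add: divide_le_eq) (metis norm_zero zero_neq_one)
    moreover have "num y e = a\<^sup>2 * num y e1"
      unfolding num_def e1(1) linear_scale[OF linF'[OF yS]]
      by (rule coord_metric_scale[OF A g dA(1) F_S[OF yS]])
    moreover have "den y e = a\<^sup>2 * den y e1"
      unfolding den_def e1(1) using coord_metric_scale[OF A g cA(1)] yS S_sub by blast
    ultimately show ?thesis
      using mult_left_mono[of "num y e1" "B * den y e1" "a\<^sup>2"] by (simp add: mult.left_commute)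
  qed

  define U where "U = V \<inter> snd c -` ball (snd c p) r"
  have "continuous_on V (snd c)"
    using chc by (auto simp: is_chart_def homeomorphism_def V_def intro: continuous_on_subset)
  then have "open U" unfolding U_def by (rule continuous_open_preimage[OF _ oV]) simp
  moreover have "p \<in> U" using r cA dA by (simp add: U_def V_def)
  moreover have "dilation_le_on U \<A> g f (sqrt B)"
    unfolding dilation_le_on_def
  proof (intro ballI)
    fix x u assume x: "x \<in> U" and u: "u \<in> tangent_space \<A> x"
    have cx: "c \<in> charts_at \<A> x" and dx: "d \<in> charts_at \<A> (f x)"
      using x cA dA by (auto simp: U_def V_def charts_at_def)
    note Tf = differential_in_tangent_space[OF A f u]
    have "F (snd c x) = snd d (f x)"
      unfolding F_def local_rep_def chart_inv_chart[OF A cx] by simp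
    then have "g (f x) (differential \<A> f x u) (differential \<A> f x u) = num (snd c x) (u c)"
      unfolding metric_eq_coord_metric[OF A dx Tf Tf] differential_eq[OF A f u cx dx]
        num_def F'_def F_def by simp
    moreover have "g x u u = den (snd c x) (u c)"
      unfolding metric_eq_coord_metric[OF A cx u u] den_def ..
    moreover have "snd c x \<in> cball (snd c p) r" using x by (simp add: U_def)
    ultimately show "tangent_norm g (f x) (differential \<A> f x u) \<le> sqrt B * tangent_norm g x u"
      unfolding tangent_norm_def real_sqrt_mult[symmetric] using bound by simp
  qed
  ultimately show ?thesis by blast
qed

lemma dilation_bounded:
  fixes \<A> :: "('m::topological_space, 'e::euclidean_space) chart set"
  assumes M: "compact (UNIV :: 'm set)" and A: "smooth_atlas \<A>" and g: "riemannian_metric \<A> g"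
    and f: "Ck_map (Suc k) \<A> f"
  shows "\<exists>K. dilation_le \<A> g f K"
proof -
  obtain U K where UK: "\<And>p. open (U p)" "\<And>p. p \<in> U p" "\<And>p. dilation_le_on (U p) \<A> g f (K p)"
    using dilation_locally_bounded[OF A g f] by metis
  have "UNIV \<subseteq> (\<Union>p\<in>UNIV. U p)" using UK(2) by auto
  then obtain P where P: "finite P" "UNIV \<subseteq> (\<Union>p\<in>P. U p)"
    by (rule compactE_image[OF M UK(1)])
  have "dilation_le_on (U p) \<A> g f (Max (K ` P))" if "p \<in> P" for p
    using dilation_le_on_mono[OF A g UK(3)] P(1) that by simp
  then have "dilation_le \<A> g f (Max (K ` P))"
    using P(2) unfolding dilation_le_on_def by blast
  then show ?thesis ..
qed

section \<open>Distortion of the centre\<close>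

text \<open>
  Each of the \<open>n m\<close> exchanges of a factor \<open>a\<close> with a factor \<open>b\<close> produces one \<open>c\<close>, which is free to
  move to the end.
\<close>

lemma (in group) heisenberg_pow_commute:
  fixes n m :: nat
  assumes abc: "a \<in> carrier G" "b \<in> carrier G" "c \<in> carrier G"
    and ac: "a \<otimes> c = c \<otimes> a" and bc: "b \<otimes> c = c \<otimes> b" and ab: "a \<otimes> b = b \<otimes> a \<otimes> c"
  shows "a [^] n \<otimes> b [^] m = b [^] m \<otimes> a [^] n \<otimes> c [^] (n * m)"
proof -
  have ca: "c [^] k \<otimes> a = a \<otimes> c [^] k" and cb: "c [^] k \<otimes> b = b \<otimes> c [^] k" for k :: nat
    using group_commutes_pow[OF ac[symmetric]] group_commutes_pow[OF bc[symmetric]] abc by auto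
  have one_b: "a [^] n \<otimes> b = b \<otimes> a [^] n \<otimes> c [^] n" for n :: nat
  proof (induction n)
    case (Suc n)
    have "a [^] Suc n \<otimes> b = a [^] n \<otimes> (a \<otimes> b)" using abc by (simp add: m_assoc)
    also have "\<dots> = (a [^] n \<otimes> b) \<otimes> (a \<otimes> c)" using abc by (simp add: ab m_assoc)
    also have "\<dots> = b \<otimes> a [^] n \<otimes> (c [^] n \<otimes> a) \<otimes> c" using abc by (simp add: Suc m_assoc)
    also have "\<dots> = b \<otimes> a [^] Suc n \<otimes> c [^] Suc n" using abc by (simp add: ca m_assoc)
    finally show ?case .
  qed (use abc in simp)
  show ?thesis
  proof (induction m)
    case (Suc m)
    have "a [^] n \<otimes> b [^] Suc m = (a [^] n \<otimes> b [^] m) \<otimes> b" using abc by (simp add: m_assoc)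
    also have "\<dots> = b [^] m \<otimes> a [^] n \<otimes> (c [^] (n * m) \<otimes> b)" using abc by (simp add: Suc m_assoc)
    also have "\<dots> = b [^] m \<otimes> (a [^] n \<otimes> b) \<otimes> c [^] (n * m)" using abc by (simp add: cb m_assoc)
    also have "\<dots> = b [^] Suc m \<otimes> a [^] n \<otimes> (c [^] n \<otimes> c [^] (n * m))"
      using abc by (simp add: one_b m_assoc)
    finally show ?case using abc by (simp add: nat_pow_mult)
  qed (use abc in simp)
qed

text \<open>
  A word of length linear in \<open>n\<close> represents a power of \<open>c\<close> whose exponent is quadratic in \<open>n\<close>. All
  estimates below rest on this distortion.
\<close>

lemma (in group) heisenberg_central_square:
  fixes n :: nat
  assumes abc: "a \<in> carrier G" "b \<in> carrier G" "c \<in> carrier G"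
    and "a \<otimes> c = c \<otimes> a" "b \<otimes> c = c \<otimes> b" "a \<otimes> b = b \<otimes> a \<otimes> c"
  shows "c [^] (n * n) = inv a [^] n \<otimes> inv b [^] n \<otimes> (a [^] n \<otimes> b [^] n)"
proof -
  let ?y = "b [^] n \<otimes> a [^] n"
  have "inv ?y \<otimes> (?y \<otimes> c [^] (n * n)) = c [^] (n * n)"
    using abc by (simp add: inv_solve_left')
  moreover have "inv ?y = inv a [^] n \<otimes> inv b [^] n"
    using abc by (simp add: inv_mult_group nat_pow_inv)
  ultimately show ?thesis using heisenberg_pow_commute[OF assms, of n n] by simp
qed

lemma hom_Diff_Ck_map:
  assumes "\<alpha> \<in> hom G (Diff k \<A>)" "x \<in> carrier G"
  shows "Ck_map k \<A> (\<alpha> x)" "bij (\<alpha> x)"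
  using hom_in_carrier[OF assms] by (auto simp: Diff_def)

lemma hom_Diff_mult:
  assumes "\<alpha> \<in> hom G (Diff k \<A>)" "x \<in> carrier G" "y \<in> carrier G"
  shows "\<alpha> (x \<otimes>\<^bsub>G\<^esub> y) = \<alpha> x \<circ> \<alpha> y"
  using hom_mult[OF assms] by (simp add: Diff_def)

lemma hom_Diff_one:
  assumes G: "group G" and \<alpha>: "\<alpha> \<in> hom G (Diff k \<A>)"
  shows "\<alpha> \<one>\<^bsub>G\<^esub> = (\<lambda>x. x)"
proof
  interpret group G by (rule G)
  fix x
  have "\<alpha> \<one>\<^bsub>G\<^esub> (\<alpha> \<one>\<^bsub>G\<^esub> x) = \<alpha> \<one>\<^bsub>G\<^esub> x"
    using hom_Diff_mult[OF \<alpha> one_closed one_closed] by (simp add: fun_eq_iff)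
  then show "\<alpha> \<one>\<^bsub>G\<^esub> x = x"
    using hom_Diff_Ck_map(2)[OF \<alpha> one_closed] by (simp add: bij_def inj_eq)
qed

lemma hom_Diff_pow:
  assumes G: "group G" and \<alpha>: "\<alpha> \<in> hom G (Diff k \<A>)" and x: "x \<in> carrier G"
  shows "\<alpha> (x [^]\<^bsub>G\<^esub> (n::nat)) = \<alpha> x ^^ n"
proof (induction n)
  case 0
  then show ?case using hom_Diff_one[OF G \<alpha>] by (simp add: id_def)
next
  case (Suc n)
  interpret group G by (rule G)
  show ?case using hom_Diff_mult[OF \<alpha> nat_pow_closed[OF x] x] Suc
    by (simp add: funpow_swap1 fun_eq_iff)
qed

lemma dilation_le_mult:
  assumes G: "group G" and A: "smooth_atlas \<A>" and \<alpha>: "\<alpha> \<in> hom G (Diff (Suc k) \<A>)"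
    and x: "x \<in> carrier G" "dilation_le \<A> g (\<alpha> x) K" "0 \<le> K"
    and y: "y \<in> carrier G" "dilation_le \<A> g (\<alpha> y) L"
  shows "dilation_le \<A> g (\<alpha> (x \<otimes>\<^bsub>G\<^esub> y)) (K * L)"
proof -
  interpret group G by (rule G)
  note C = hom_Diff_Ck_map(1)[OF \<alpha>]
  show ?thesis
    using dilation_le_comp[OF A C[OF y(1)] C[OF x(1)] _ y(2) x(2,3)] C[OF m_closed[OF x(1) y(1)]]
    unfolding hom_Diff_mult[OF \<alpha> x(1) y(1)] by blast
qed

lemma dilation_le_pow:
  assumes G: "group G" and A: "smooth_atlas \<A>" and \<alpha>: "\<alpha> \<in> hom G (Diff (Suc k) \<A>)"
    and x: "x \<in> carrier G" and K: "dilation_le \<A> g (\<alpha> x) K" "0 \<le> K"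
  shows "dilation_le \<A> g (\<alpha> (x [^]\<^bsub>G\<^esub> (n::nat))) (K ^ n)"
proof (induction n)
  case 0
  show ?case
    using differential_ident[OF A] by (simp add: dilation_le_on_def hom_Diff_one[OF G \<alpha>])
next
  case (Suc n)
  interpret group G by (rule G)
  show ?case
    using dilation_le_mult[OF G A \<alpha> nat_pow_closed[OF x] Suc _ x K(1)] K(2)
    by (simp add: mult.commute)
qed

text \<open>
  Write \<open>N = s\<^sup>2 + r\<close> with \<open>s = \<lfloor>\<surd>N\<rfloor>\<close>, so \<open>r \<le> 2 s\<close>. The power \<open>c\<^bsup>s\<^sup>2\<^esup>\<close> costs \<open>4 s\<close> letters and the
  remaining \<open>c\<^sup>r\<close> at most \<open>2 s\<close> more. With a common bound \<open>K\<close> for all letters, the dilation is at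
  most \<open>K\<^bsup>6s\<^esup>\<close>.
\<close>

lemma dilation_central_subexponential:
  fixes \<A> :: "('m::topological_space, 'e::euclidean_space) chart set" and G (structure)
  assumes M: "compact (UNIV :: 'm set)" and A: "smooth_atlas \<A>" and g: "riemannian_metric \<A> g"
    and G: "group G" and \<alpha>: "\<alpha> \<in> hom G (Diff (Suc k) \<A>)"
    and abc: "a \<in> carrier G" "b \<in> carrier G" "c \<in> carrier G"
    and rels: "a \<otimes> c = c \<otimes> a" "b \<otimes> c = c \<otimes> b" "a \<otimes> b = b \<otimes> a \<otimes> c"
  shows "\<exists>\<kappa>\<ge>0. \<forall>N::nat. dilation_le \<A> g (\<alpha> (c [^] N)) (exp (\<kappa> * sqrt (real N)))"
proof -
  interpret group G by (rule G)
  have "\<exists>K. dilation_le \<A> g (\<alpha> x) K" if "x \<in> carrier G" for x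
    by (rule dilation_bounded[OF M A g hom_Diff_Ck_map(1)[OF \<alpha> that]])
  then obtain D where D: "\<And>x. x \<in> carrier G \<Longrightarrow> dilation_le \<A> g (\<alpha> x) (D x)" by metis
  define S where "S = {a, b, c, inv a, inv b}"
  define K where "K = Max (insert 1 (D ` S))"
  have S: "finite S" "S \<subseteq> carrier G" using abc by (auto simp: S_def)
  have K1: "1 \<le> K" unfolding K_def using S by simp
  have KS: "dilation_le \<A> g (\<alpha> x) K" if "x \<in> S" for x
  proof (rule dilation_le_on_mono[OF A g])
    show "dilation_le \<A> g (\<alpha> x) (D x)" using D S that by blast
    show "D x \<le> K" unfolding K_def using S that by simp
  qed
  have pow: "dilation_le \<A> g (\<alpha> (x [^] n)) (K ^ n)" if "x \<in> S" for x and n :: nat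
    using dilation_le_pow[OF G A \<alpha> _ KS[OF that]] S that K1 by auto
  have "dilation_le \<A> g (\<alpha> (c [^] N)) (exp (6 * ln K * sqrt (real N)))" for N :: nat
  proof -
    define s where "s = floor_sqrt N"
    define r where "r = N - s * s"
    have s: "s * s \<le> N" "N < Suc s * Suc s"
      using floor_sqrt_power2_le[of N] Suc_floor_sqrt_power2_gt[of N]
      by (simp_all add: s_def power2_eq_square)
    then have r: "N = s * s + r" "r \<le> 2 * s" by (simp_all add: r_def)
    have cN: "c [^] N = inv a [^] s \<otimes> inv b [^] s \<otimes> (a [^] s \<otimes> b [^] s) \<otimes> c [^] r"
      unfolding heisenberg_central_square[OF abc rels, symmetric] r(1)
      using abc by (simp add: nat_pow_mult)
    have "dilation_le \<A> g (\<alpha> (c [^] N)) (K ^ s * K ^ s * (K ^ s * K ^ s) * K ^ r)"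
      unfolding cN using K1 abc
      by (intro dilation_le_mult[OF G A \<alpha>] pow m_closed nat_pow_closed inv_closed)
        (auto simp: S_def)
    moreover have "K ^ s * K ^ s * (K ^ s * K ^ s) * K ^ r \<le> exp (6 * ln K * sqrt (real N))"
    proof -
      have "K ^ s * K ^ s * (K ^ s * K ^ s) * K ^ r = K ^ (4 * s + r)"
        by (simp add: power_add[symmetric] numeral_eq_Suc algebra_simps)
      also have "\<dots> \<le> K ^ (6 * s)" using r(2) K1 by (intro power_increasing) auto
      also have "\<dots> = exp (real (6 * s) * ln K)" using K1 exp_of_nat_mult[of "6 * s" "ln K"] by simp
      also have "\<dots> \<le> exp (6 * ln K * sqrt (real N))"
      proof -
        have "real s \<le> sqrt (real N)"
          using s(1) by (intro real_le_rsqrt) (simp add: power2_eq_square flip: of_nat_mult)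
        then show ?thesis using mult_left_mono[of "real s" "sqrt (real N)" "ln K"] K1 by (simp add: mult.commute)
      qed
      finally show ?thesis .
    qed
    ultimately show ?thesis by (rule dilation_le_on_mono[OF A g])
  qed
  moreover have "0 \<le> 6 * ln K" using K1 by simp
  ultimately show ?thesis by blast
qed

text \<open>
  The lower bound is the upper bound for \<open>inv c\<close>, applied to the image of \<open>u\<close>: the hypotheses on
  \<open>(a, b, c)\<close> also hold for \<open>(b, a, inv c)\<close>.
\<close>

lemma central_differential_bounds:
  fixes \<A> :: "('m::topological_space, 'e::euclidean_space) chart set" and G (structure)
  assumes M: "compact (UNIV :: 'm set)" and A: "smooth_atlas \<A>" and g: "riemannian_metric \<A> g"
    and G: "group G" and \<alpha>: "\<alpha> \<in> hom G (Diff (Suc k) \<A>)"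
    and abc: "a \<in> carrier G" "b \<in> carrier G" "c \<in> carrier G"
    and rels: "a \<otimes> c = c \<otimes> a" "b \<otimes> c = c \<otimes> b" "a \<otimes> b = b \<otimes> a \<otimes> c"
  shows "\<exists>\<kappa>\<ge>0. \<forall>N p. \<forall>u\<in>tangent_space \<A> p.
    tangent_norm g ((\<alpha> c ^^ N) p) (differential \<A> (\<alpha> c ^^ N) p u)
      \<le> exp (\<kappa> * sqrt (real N)) * tangent_norm g p u \<and>
    exp (- (\<kappa> * sqrt (real N))) * tangent_norm g p u
      \<le> tangent_norm g ((\<alpha> c ^^ N) p) (differential \<A> (\<alpha> c ^^ N) p u)"
proof -
  interpret group G by (rule G)
  obtain \<kappa>1 where k1: "\<kappa>1 \<ge> 0" "\<And>N. dilation_le \<A> g (\<alpha> (c [^] N)) (exp (\<kappa>1 * sqrt (real N)))"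
    using dilation_central_subexponential[OF M A g G \<alpha> abc rels] by blast
  have "b \<otimes> inv c = inv c \<otimes> b" "a \<otimes> inv c = inv c \<otimes> a"
    using rels abc by (metis inv_closed inv_solve_left inv_solve_right m_assoc m_closed)+
  moreover have "b \<otimes> a = a \<otimes> b \<otimes> inv c"
    using abc by (simp add: rels(3) m_assoc)
  ultimately obtain \<kappa>2 where
    k2: "\<kappa>2 \<ge> 0" "\<And>N. dilation_le \<A> g (\<alpha> (inv c [^] N)) (exp (\<kappa>2 * sqrt (real N)))"
    using dilation_central_subexponential[OF M A g G \<alpha> abc(2,1) inv_closed[OF abc(3)]] by blast
  define \<kappa> where "\<kappa> = max \<kappa>1 \<kappa>2"
  have K: "dilation_le \<A> g (\<alpha> (c [^] N)) (exp (\<kappa> * sqrt (real N)))"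
    "dilation_le \<A> g (\<alpha> (inv c [^] N)) (exp (\<kappa> * sqrt (real N)))" for N :: nat
    by (rule dilation_le_on_mono[OF A g k1(2)] dilation_le_on_mono[OF A g k2(2)];
        simp add: \<kappa>_def mult_right_mono)+
  have pow: "\<alpha> c ^^ N = \<alpha> (c [^] N)" for N :: nat
    using hom_Diff_pow[OF G \<alpha> abc(3)] by simp
  show ?thesis
  proof (intro exI[of _ \<kappa>] conjI allI ballI)
    show "\<kappa> \<ge> 0" using k1(1) by (simp add: \<kappa>_def)
    fix N p u assume u: "u \<in> tangent_space \<A> p"
    show "tangent_norm g ((\<alpha> c ^^ N) p) (differential \<A> (\<alpha> c ^^ N) p u)
        \<le> exp (\<kappa> * sqrt (real N)) * tangent_norm g p u"
      using K(1) u unfolding pow dilation_le_on_def by blast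
    define f where "f = \<alpha> (c [^] N)"
    define f' where "f' = \<alpha> (inv c [^] N)"
    have cl: "c [^] N \<in> carrier G" "inv c [^] N \<in> carrier G" using abc by simp_all
    have "inv c [^] N \<otimes> c [^] N = \<one>" using abc by (simp add: nat_pow_inv)
    then have f'f: "f' \<circ> f = (\<lambda>x. x)"
      unfolding f_def f'_def using hom_Diff_mult[OF \<alpha> cl(2,1)] hom_Diff_one[OF G \<alpha>] by simp
    have Ck: "Ck_map (Suc k) \<A> f" "Ck_map (Suc k) \<A> f'"
      unfolding f_def f'_def by (rule hom_Diff_Ck_map(1)[OF \<alpha>], rule cl)+
    have "u = differential \<A> f' (f p) (differential \<A> f p u)"
      using differential_comp[OF A Ck _ u] differential_ident[OF A u] Ck_map_id[OF A]
      unfolding f'f by metis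
    moreover have "p = f' (f p)" using f'f by (simp add: fun_eq_iff)
    moreover have "tangent_norm g (f' (f p)) (differential \<A> f' (f p) (differential \<A> f p u))
        \<le> exp (\<kappa> * sqrt (real N)) * tangent_norm g (f p) (differential \<A> f p u)"
      using K(2) differential_in_tangent_space[OF A Ck(1) u] unfolding f'_def dilation_le_on_def by blast
    ultimately have "tangent_norm g p u
        \<le> exp (\<kappa> * sqrt (real N)) * tangent_norm g (f p) (differential \<A> f p u)" by metis
    then show "exp (- (\<kappa> * sqrt (real N))) * tangent_norm g p u
        \<le> tangent_norm g ((\<alpha> c ^^ N) p) (differential \<A> (\<alpha> c ^^ N) p u)"
      unfolding pow f_def[symmetric] exp_minus by (simp add: field_simps)
  qed
qed

section \<open>Exponents and eigenvalues\<close>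

lemma lyapunov_exponent_zeroI:
  assumes pos: "tangent_norm g x u > 0"
    and upper: "\<And>N. tangent_norm g ((h ^^ N) x) (differential \<A> (h ^^ N) x u)
      \<le> exp (\<kappa> * sqrt (real N)) * tangent_norm g x u"
    and lower: "\<And>N. exp (- (\<kappa> * sqrt (real N))) * tangent_norm g x u
      \<le> tangent_norm g ((h ^^ N) x) (differential \<A> (h ^^ N) x u)"
  shows "has_lyapunov_exponent \<A> g h x u 0"
proof -
  define t where "t = tangent_norm g x u"
  define T where "T = (\<lambda>N. tangent_norm g ((h ^^ N) x) (differential \<A> (h ^^ N) x u))"
  have t: "t > 0" using pos by (simp add: t_def)
  have T: "ln t - \<kappa> * sqrt (real N) \<le> ln (T N)" "ln (T N) \<le> ln t + \<kappa> * sqrt (real N)" for N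
  proof -
    have *: "exp (- (\<kappa> * sqrt (real N))) * t \<le> T N" "T N \<le> exp (\<kappa> * sqrt (real N)) * t"
      using upper lower by (simp_all add: t_def T_def)
    moreover have "0 < exp (- (\<kappa> * sqrt (real N))) * t" using t by simp
    ultimately have "ln (exp (- (\<kappa> * sqrt (real N))) * t) \<le> ln (T N)"
      "ln (T N) \<le> ln (exp (\<kappa> * sqrt (real N)) * t)"
      by (simp_all only: ln_mono)
    then show "ln t - \<kappa> * sqrt (real N) \<le> ln (T N)" "ln (T N) \<le> ln t + \<kappa> * sqrt (real N)"
      using t by (simp_all add: ln_mult)
  qed
  have "(\<lambda>N. 1 / real N * ln (T N)) \<longlonglongrightarrow> 0"
  proof (rule tendsto_sandwich)
    show "\<forall>\<^sub>F N in sequentially. 1 / real N * (ln t - \<kappa> * sqrt (real N)) \<le> 1 / real N * ln (T N)"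
      "\<forall>\<^sub>F N in sequentially. 1 / real N * ln (T N) \<le> 1 / real N * (ln t + \<kappa> * sqrt (real N))"
      using T by (intro always_eventually allI mult_left_mono; simp)+
    show "(\<lambda>N. 1 / real N * (ln t - \<kappa> * sqrt (real N))) \<longlonglongrightarrow> 0"
      "(\<lambda>N. 1 / real N * (ln t + \<kappa> * sqrt (real N))) \<longlonglongrightarrow> 0"
      by real_asymp+
  qed
  then show ?thesis by (simp add: has_lyapunov_exponent_def T_def)
qed

text \<open>
  On the span of the real and imaginary parts of the eigenvector \<open>u + \<i> w\<close> the differential acts as
  multiplication by \<open>z\<close>, for which the two cross terms in \<open>g p u w\<close> cancel, whatever the
  angle between \<open>u\<close> and \<open>w\<close>. Since the images of \<open>u\<close> and \<open>w\<close> satisfy the same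
  eigenvector equations, this can be iterated; the induction is therefore over all such pairs.
\<close>

lemma eigenvector_norm_funpow:
  assumes A: "smooth_atlas \<A>" and g: "riemannian_metric \<A> g"
    and f: "\<And>m. Ck_map (Suc k) \<A> (f ^^ m)" and p: "f p = p"
    and uw: "u \<in> tangent_space \<A> p" "w \<in> tangent_space \<A> p"
    and eig: "differential \<A> f p u = (\<lambda>i. Re z *\<^sub>R u i - Im z *\<^sub>R w i)"
      "differential \<A> f p w = (\<lambda>i. Im z *\<^sub>R u i + Re z *\<^sub>R w i)"
  shows "(tangent_norm g p (differential \<A> (f ^^ m) p u))\<^sup>2
      + (tangent_norm g p (differential \<A> (f ^^ m) p w))\<^sup>2
    = (cmod z ^ m)\<^sup>2 * ((tangent_norm g p u)\<^sup>2 + (tangent_norm g p w)\<^sup>2)"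
  using uw eig
proof (induction m arbitrary: u w)
  case 0
  then show ?case using differential_ident[OF A] by (simp add: id_def)
next
  case (Suc m u w)
  have f1: "Ck_map (Suc k) \<A> f" using f[of 1] by simp
  let ?L = "differential \<A> f p"
  have L: "?L v \<in> tangent_space \<A> p" if "v \<in> tangent_space \<A> p" for v
    using differential_in_tangent_space[OF A f1 that] p by simp
  have step: "differential \<A> (f ^^ Suc m) p v = differential \<A> (f ^^ m) p (?L v)"
    if "v \<in> tangent_space \<A> p" for v
    using differential_comp[OF A f1 f[of m] _ that] f[of "Suc m"] p
    unfolding funpow_Suc_right by simp
  have nsq: "(tangent_norm g p v)\<^sup>2 = g p v v" if "v \<in> tangent_space \<A> p" for v
    using metric_nonneg[OF A g that] by (simp add: tangent_norm_def)
  have "?L (?L u) = (\<lambda>i. Re z *\<^sub>R ?L u i - Im z *\<^sub>R ?L w i)"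
    using differential_lincomb[OF A f1 Suc.prems(1,2), of "Re z" "- Im z"] Suc.prems(3) by simp
  moreover have "?L (?L w) = (\<lambda>i. Im z *\<^sub>R ?L u i + Re z *\<^sub>R ?L w i)"
    using differential_lincomb[OF A f1 Suc.prems(1,2), of "Im z" "Re z"] Suc.prems(4) by simp
  ultimately have IH: "(tangent_norm g p (differential \<A> (f ^^ m) p (?L u)))\<^sup>2
      + (tangent_norm g p (differential \<A> (f ^^ m) p (?L w)))\<^sup>2
    = (cmod z ^ m)\<^sup>2 * ((tangent_norm g p (?L u))\<^sup>2 + (tangent_norm g p (?L w))\<^sup>2)"
    by (intro Suc.IH L Suc.prems(1,2))
  have "(tangent_norm g p (?L u))\<^sup>2 + (tangent_norm g p (?L w))\<^sup>2
      = (cmod z)\<^sup>2 * ((tangent_norm g p u)\<^sup>2 + (tangent_norm g p w)\<^sup>2)"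
  proof -
    note T = Suc.prems(1,2)
    define x y where "x = Re z" and "y = Im z"
    have Lu: "?L u = (\<lambda>i. x *\<^sub>R u i + (- y) *\<^sub>R w i)" and Lw: "?L w = (\<lambda>i. y *\<^sub>R u i + x *\<^sub>R w i)"
      using Suc.prems(3,4) by (simp_all add: x_def y_def)
    have sq: "g p (\<lambda>i. a *\<^sub>R u i + b *\<^sub>R w i) (\<lambda>i. a *\<^sub>R u i + b *\<^sub>R w i)
        = a\<^sup>2 * g p u u + 2 * a * b * g p u w + b\<^sup>2 * g p w w" for a b
      unfolding metric_lincomb_left[OF A g T tangent_space_lincomb[OF A T]]
        metric_lincomb_right[OF A g T T(1)] metric_lincomb_right[OF A g T T(2)]
        metric_sym[OF g T(2,1)]
      by (simp add: power2_eq_square algebra_simps)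
    have "g p (?L u) (?L u) + g p (?L w) (?L w) = (x\<^sup>2 + y\<^sup>2) * (g p u u + g p w w)"
      unfolding Lu Lw sq by (simp add: power2_eq_square algebra_simps)
    then show ?thesis
      unfolding nsq[OF T(1)] nsq[OF T(2)] nsq[OF L[OF T(1)]] nsq[OF L[OF T(2)]]
      by (simp add: cmod_power2 x_def y_def)
  qed
  then show ?case
    unfolding step[OF Suc.prems(1)] step[OF Suc.prems(2)] IH
    by (simp add: power_mult_distrib)
qed

text \<open>
  At \<open>m = n j\<^sup>2\<close> the square root is the integer \<open>n j\<close>; taking \<open>j\<close>-th roots there shows that all powers
  of \<open>r\<^sup>n\<close> lie between \<open>exp (- \<kappa> n)\<close> and \<open>exp (\<kappa> n)\<close>, which is only possible if \<open>r\<^sup>n = 1\<close>.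
\<close>

lemma subexponential_powers_imp_one:
  fixes r \<kappa> :: real and n :: nat
  assumes r: "0 \<le> r" and n: "0 < n" and \<kappa>: "0 \<le> \<kappa>"
    and upper: "\<And>m. r ^ m \<le> exp (\<kappa> * sqrt (real (n * m)))"
    and lower: "\<And>m. exp (- (\<kappa> * sqrt (real (n * m)))) \<le> r ^ m"
  shows "r = 1"
proof -
  have sq: "sqrt (real (n * (n * j * j))) = real (n * j)" for j :: nat
    by (intro real_sqrt_unique) (simp_all add: power2_eq_square algebra_simps)
  have "(r ^ n) ^ j \<le> exp (\<kappa> * n)" for j
  proof (cases j)
    case (Suc i)
    have "((r ^ n) ^ j) ^ j \<le> exp (\<kappa> * n) ^ j"
      using upper[of "n * j * j"] unfolding sq
      by (simp add: power_mult[symmetric] exp_of_nat_mult[symmetric] mult_ac)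
    then show ?thesis unfolding Suc by (rule power_le_imp_le_base) simp
  qed (use \<kappa> in simp)
  then have "\<not> 1 < r ^ n" using real_arch_pow[of "r ^ n" "exp (\<kappa> * n)"] by (meson not_le)
  moreover have "exp (- (\<kappa> * n)) \<le> (r ^ n) ^ j" for j
  proof (cases j)
    case (Suc i)
    have "exp (- (\<kappa> * n)) ^ j \<le> ((r ^ n) ^ j) ^ j"
      using lower[of "n * j * j"] unfolding sq
      by (simp add: power_mult[symmetric] exp_of_nat_mult[symmetric] mult_ac)
    then show ?thesis unfolding Suc by (rule power_le_imp_le_base) (use r in simp)
  qed (use \<kappa> in simp)
  then have "\<not> r ^ n < 1"
    using real_arch_pow_inv[of "exp (- (\<kappa> * n))" "r ^ n"] by (meson exp_gt_zero not_le)
  ultimately have "r ^ n = 1" by simp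
  then show ?thesis using r n power_eq_iff_eq_base[of n r 1] by simp
qed

lemma heisenberg_generators:
  defines "a \<equiv> word_class heis_rels [(Gen_A, True)]" and "b \<equiv> word_class heis_rels [(Gen_B, True)]"
  shows "a \<in> carrier heisenberg" "b \<in> carrier heisenberg" "heis_C \<in> carrier heisenberg"
    and "a \<otimes>\<^bsub>heisenberg\<^esub> heis_C = heis_C \<otimes>\<^bsub>heisenberg\<^esub> a"
      "b \<otimes>\<^bsub>heisenberg\<^esub> heis_C = heis_C \<otimes>\<^bsub>heisenberg\<^esub> b"
      "a \<otimes>\<^bsub>heisenberg\<^esub> b = b \<otimes>\<^bsub>heisenberg\<^esub> a \<otimes>\<^bsub>heisenberg\<^esub> heis_C"
proof -
  show "a \<in> carrier heisenberg" "b \<in> carrier heisenberg" "heis_C \<in> carrier heisenberg"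
    by (simp_all add: a_def b_def heis_C_def heisenberg_def presented_group_def)
  have rel: "word_class heis_rels l = word_class heis_rels r" if "(l, r) \<in> heis_rels" for l r
    unfolding word_class_eq_iff using word_cong.relation[OF that, of "[]" "[]"] by simp
  show "a \<otimes>\<^bsub>heisenberg\<^esub> heis_C = heis_C \<otimes>\<^bsub>heisenberg\<^esub> a"
    "b \<otimes>\<^bsub>heisenberg\<^esub> heis_C = heis_C \<otimes>\<^bsub>heisenberg\<^esub> b"
    "a \<otimes>\<^bsub>heisenberg\<^esub> b = b \<otimes>\<^bsub>heisenberg\<^esub> a \<otimes>\<^bsub>heisenberg\<^esub> heis_C"
    unfolding a_def b_def heis_C_def heisenberg_def presented_group_mult
    by (rule rel, simp add: heis_rels_def Let_def)+
qed

theorem corollaryA1: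
  fixes \<A> :: "('m::{t2_space, second_countable_topology}, 'e::euclidean_space) chart set"
    and g :: "'m \<Rightarrow> ('m, 'e) tangent \<Rightarrow> ('m, 'e) tangent \<Rightarrow> real"
    and \<alpha> :: "heis_gen gword set \<Rightarrow> 'm \<Rightarrow> 'm"
    and h :: "'m \<Rightarrow> 'm"
  assumes "compact (UNIV :: 'm set)"
    and "smooth_atlas \<A>"
    and "riemannian_metric \<A> g"
    and "\<alpha> \<in> hom heisenberg (Diff 2 \<A>)"
    and "h = \<alpha> heis_C"
  shows "(\<forall>\<mu>\<in>invariant_measures \<alpha>. AE x in \<mu>. \<forall>u\<in>tangent_space \<A> x.
            u \<noteq> (\<lambda>c. 0) \<longrightarrow> has_lyapunov_exponent \<A> g h x u 0) \<and>
         (\<forall>n::nat. n > 0 \<longrightarrow> finite {p. (h ^^ n) p = p} \<longrightarrow>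
            (\<forall>p. (h ^^ n) p = p \<longrightarrow>
              (\<forall>z. complex_eigenvalue (tangent_space \<A> p) (differential \<A> (h ^^ n) p) z \<longrightarrow>
                 cmod z = 1)))"
proof -
  note A = assms(2) and g = assms(3)
  have \<alpha>: "\<alpha> \<in> hom heisenberg (Diff (Suc 1) \<A>)" using assms(4) by (simp add: numeral_2_eq_2)
  obtain \<kappa> where \<kappa>: "\<kappa> \<ge> 0"
    and upper: "\<And>N p u. u \<in> tangent_space \<A> p \<Longrightarrow>
      tangent_norm g ((h ^^ N) p) (differential \<A> (h ^^ N) p u)
        \<le> exp (\<kappa> * sqrt (real N)) * tangent_norm g p u"
    and lower: "\<And>N p u. u \<in> tangent_space \<A> p \<Longrightarrow>
      exp (- (\<kappa> * sqrt (real N))) * tangent_norm g p u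
        \<le> tangent_norm g ((h ^^ N) p) (differential \<A> (h ^^ N) p u)"
    using central_differential_bounds[OF assms(1) A g group_heisenberg \<alpha> heisenberg_generators]
    unfolding assms(5) by metis
  have exponents: "has_lyapunov_exponent \<A> g h x u 0"
    if u: "u \<in> tangent_space \<A> x" "u \<noteq> (\<lambda>c. 0)" for x u
    by (rule lyapunov_exponent_zeroI[OF tangent_norm_pos[OF g u] upper[OF u(1)] lower[OF u(1)]])
  have "cmod z = 1"
    if n: "n > 0" and p: "(h ^^ n) p = p"
      and z: "complex_eigenvalue (tangent_space \<A> p) (differential \<A> (h ^^ n) p) z" for n p z
  proof -
    obtain u w where u: "u \<in> tangent_space \<A> p" and w: "w \<in> tangent_space \<A> p"
      and nz: "u \<noteq> (\<lambda>i. 0) \<or> w \<noteq> (\<lambda>i. 0)"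
      and eig: "differential \<A> (h ^^ n) p u = (\<lambda>i. Re z *\<^sub>R u i - Im z *\<^sub>R w i)"
        "differential \<A> (h ^^ n) p w = (\<lambda>i. Im z *\<^sub>R u i + Re z *\<^sub>R w i)"
      using z unfolding complex_eigenvalue_def by blast
    define Q where "Q = (tangent_norm g p u)\<^sup>2 + (tangent_norm g p w)\<^sup>2"
    have Q: "Q > 0"
      using nz tangent_norm_pos[OF g u] tangent_norm_pos[OF g w]
      by (auto simp: Q_def intro: add_pos_nonneg add_nonneg_pos)
    have Ck: "Ck_map (Suc 1) \<A> (h ^^ N)" for N
      using hom_Diff_Ck_map(1)[OF \<alpha>] hom_Diff_pow[OF group_heisenberg \<alpha> heisenberg_generators(3)]
        monoid.nat_pow_closed[OF group.is_monoid[OF group_heisenberg] heisenberg_generators(3)]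
      unfolding assms(5) by metis
    have QN: "(tangent_norm g p (differential \<A> (h ^^ (n * m)) p u))\<^sup>2
        + (tangent_norm g p (differential \<A> (h ^^ (n * m)) p w))\<^sup>2 = (cmod z ^ m)\<^sup>2 * Q" for m
      using eigenvector_norm_funpow[OF A g _ p u w eig, of 1 m] Ck
      unfolding funpow_mult Q_def by simp
    have pN: "(h ^^ (n * m)) p = p" for m
      unfolding funpow_mult[symmetric] using p by (induction m) simp_all
    have nn: "0 \<le> tangent_norm g p v" if "v \<in> tangent_space \<A> p" for v
      using metric_nonneg[OF A g that] by (simp add: tangent_norm_def)
    have Tm: "differential \<A> (h ^^ (n * m)) p v \<in> tangent_space \<A> p"
      if "v \<in> tangent_space \<A> p" for m v
      using differential_in_tangent_space[OF A Ck that, of "n * m"] unfolding pN .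
    have "cmod z ^ m \<le> exp (\<kappa> * sqrt (real (n * m)))" for m
    proof -
      let ?E = "exp (\<kappa> * sqrt (real (n * m)))"
      have "(tangent_norm g p (differential \<A> (h ^^ (n * m)) p v))\<^sup>2 \<le> ?E\<^sup>2 * (tangent_norm g p v)\<^sup>2"
        if "v \<in> tangent_space \<A> p" for v
        using power_mono[OF upper[OF that, of "n * m"], of 2] nn[OF Tm[OF that]]
        unfolding pN power_mult_distrib by blast
      then have "(cmod z ^ m)\<^sup>2 * Q \<le> ?E\<^sup>2 * Q"
        unfolding QN[symmetric] unfolding Q_def distrib_left using u w by (intro add_mono)
      then have "(cmod z ^ m)\<^sup>2 \<le> ?E\<^sup>2" using Q by simp
      then show ?thesis by (rule power2_le_imp_le) simp
    qed
    moreover have "exp (- (\<kappa> * sqrt (real (n * m)))) \<le> cmod z ^ m" for m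
    proof -
      let ?E = "exp (- (\<kappa> * sqrt (real (n * m))))"
      have "?E\<^sup>2 * (tangent_norm g p v)\<^sup>2 \<le> (tangent_norm g p (differential \<A> (h ^^ (n * m)) p v))\<^sup>2"
        if "v \<in> tangent_space \<A> p" for v
        using power_mono[OF lower[OF that, of "n * m"], of 2] nn[OF that]
        unfolding pN power_mult_distrib by simp
      then have "?E\<^sup>2 * Q \<le> (cmod z ^ m)\<^sup>2 * Q"
        unfolding QN[symmetric] unfolding Q_def distrib_left using u w by (intro add_mono)
      then have "?E\<^sup>2 \<le> (cmod z ^ m)\<^sup>2" using Q by simp
      then show ?thesis by (rule power2_le_imp_le) simp
    qed
    ultimately show ?thesis by (rule subexponential_powers_imp_one[OF norm_ge_zero n \<kappa>])
  qed
  with exponents show ?thesis by simp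
qed

end
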